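(* Let $f:\mathbb{R}^N\to\mathbb{R}^N$ be $C^2$, equivariant with respect to a compact group $\Gamma\subseteq O(N)$, and let $x_\ast$ be a periodic solution of $\dot x=f(x)$ with minimal period $p>0$ which is a discrete wave with $H/K\cong\mathbb{Z}_n$. Fix a spatio-temporal symmetry $h\in H$ and $b\in\mathbb{R}$, and let $m\in\{1,\dots,n\}$ be such that $\theta_h=\frac{m}{n}p$. Let $U(t,s)$, $t\ge s$, be the family of solution operators of the linear DDE $$\dot y(t)=f'(x_\ast(t))y(t)+b\,[y(t)-h\,y(t-\theta_h)],$$ and let $U_h=h^{-1}U(\tfrac{m}{n}p,0)$ be the twisted monodromy operator. Then $$U(p,0)^m=h^nU_h^n.$$
   Context: $\Gamma$-equivariance means $f(\gamma x)=\gamma f(x)$ for all $x\in\mathbb{R}^N$, $\gamma\in\Gamma$. $K=\{\gamma\in\Gamma\mid\gamma x_\ast(0)=x_\ast(0)\}$, $H=\{\gamma\in\Gamma\mid\gamma\mathcal{O}=\mathcal{O}\}$ with $\mathcal{O}$ the orbit of $x_\ast$; for $h\in H$, $\theta_h\in[0,p)$ is defined by $hx_\ast(t)=x_\ast(t+\theta_h)$. $U(t,s)$ acts on $C([-\theta_h,0],\mathbb{R}^N)$, mapping an initial history $\varphi$ at time $s$ (i.e. $y(s+\vartheta)=\varphi(\vartheta)$, $\vartheta\in[-\theta_h,0]$) to the history segment $y_t(\vartheta)=y(t+\vartheta)$ of the solution. Matrices act on this function space pointwise. *)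

theory Defs
  imports "HOL-Analysis.Analysis" "HOL-Algebra.Elementary_Groups"
begin

text \<open>Compact subgroup of the orthogonal group O(N), N = CARD('n).\<close>
definition compact_orth_group :: "(real^'n^'n) set \<Rightarrow> bool" where
  "compact_orth_group G \<longleftrightarrow> compact G \<and> mat 1 \<in> G \<and>
     (\<forall>g\<in>G. orthogonal_matrix g) \<and>
     (\<forall>g\<in>G. \<forall>g'\<in>G. g ** g' \<in> G) \<and> (\<forall>g\<in>G. matrix_inv g \<in> G)"

definition equivariant :: "(real^'n^'n) set \<Rightarrow> (real^'n \<Rightarrow> real^'n) \<Rightarrow> bool" where
  "equivariant G f \<longleftrightarrow> (\<forall>g\<in>G. \<forall>x. f (g *v x) = g *v f x)"

text \<open>Isotropy subgroup K of x(0) and spatio-temporal symmetry group H of the orbit.\<close>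
definition Kgrp :: "(real^'n^'n) set \<Rightarrow> (real \<Rightarrow> real^'n) \<Rightarrow> (real^'n^'n) set" where
  "Kgrp G x = {g\<in>G. g *v x 0 = x 0}"

definition Hgrp :: "(real^'n^'n) set \<Rightarrow> (real \<Rightarrow> real^'n) \<Rightarrow> (real^'n^'n) set" where
  "Hgrp G x = {g\<in>G. (\<lambda>v. g *v v) ` range x = range x}"

text \<open>H as a group (under matrix multiplication), in the HOL-Algebra sense.\<close>
definition mat_group :: "(real^'n^'n) set \<Rightarrow> (real^'n^'n) monoid" where
  "mat_group S = \<lparr>carrier = S, monoid.mult = (**), one = mat 1\<rparr>"

text \<open>theta_h in [0,p) with h x(t) = x(t + theta_h).\<close>
definition theta :: "real \<Rightarrow> (real \<Rightarrow> real^'n) \<Rightarrow> real^'n^'n \<Rightarrow> real" where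
  "theta p x h = (THE th. 0 \<le> th \<and> th < p \<and> (\<forall>t. h *v x t = x (t + th)))"

text \<open>Solution of the linear DDE
  y'(t) = Df(x(t)) y(t) + b (y(t) - h y(t - th)) for t \<ge> s with history phi on [-th,0]
  at time s; y is set to 0 before s - th (normalisation making it unique).\<close>
definition dde_sol ::
  "(real^'n \<Rightarrow> (real^'n) \<Rightarrow>\<^sub>L (real^'n)) \<Rightarrow> (real \<Rightarrow> real^'n) \<Rightarrow> real \<Rightarrow> real^'n^'n \<Rightarrow> real
   \<Rightarrow> real \<Rightarrow> (real \<Rightarrow> real^'n) \<Rightarrow> (real \<Rightarrow> real^'n) \<Rightarrow> bool" where
  "dde_sol Df x b h th s phi y \<longleftrightarrow>
     continuous_on {s - th..} y \<and>
     (\<forall>r. r < s - th \<longrightarrow> y r = 0) \<and>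
     (\<forall>v\<in>{-th..0}. y (s + v) = phi v) \<and>
     (\<forall>t\<ge>s. (y has_vector_derivative
         (Df (x t) (y t) + b *\<^sub>R (y t - h *v y (t - th)))) (at t within {s..}))"

text \<open>Phase space C([-th,0], R^N); functions are extended by 0 outside [-th,0].\<close>
definition Cspace :: "real \<Rightarrow> (real \<Rightarrow> real^'n) set" where
  "Cspace th = {phi. continuous_on {-th..0} phi \<and> (\<forall>v. v \<notin> {-th..0} \<longrightarrow> phi v = 0)}"

text \<open>Solution operator U(t,s): history at s mapped to the segment y_t.\<close>
definition solop ::
  "(real^'n \<Rightarrow> (real^'n) \<Rightarrow>\<^sub>L (real^'n)) \<Rightarrow> (real \<Rightarrow> real^'n) \<Rightarrow> real \<Rightarrow> real^'n^'n \<Rightarrow> real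
   \<Rightarrow> real \<Rightarrow> real \<Rightarrow> (real \<Rightarrow> real^'n) \<Rightarrow> (real \<Rightarrow> real^'n)" where
  "solop Df x b h th t s phi =
     (let y = (THE y. dde_sol Df x b h th s phi y)
      in (\<lambda>v. if v \<in> {-th..0} then y (t + v) else 0))"

text \<open>Pointwise action of a matrix on the function space.\<close>
definition mat_act :: "real^'n^'n \<Rightarrow> (real \<Rightarrow> real^'n) \<Rightarrow> (real \<Rightarrow> real^'n)" where
  "mat_act M phi = (\<lambda>v. M *v phi v)"

end

theory Submission
  imports Defs "HOL-Analysis.Lipschitz"
begin

(*
  By uniqueness for the ODE, h maps the periodic orbit onto a time shift of itself,
  h x(t) = x(t + theta_h), and differentiating the equivariance of f gives
  f'(x(t + theta_h)) h = h f'(x(t)). Hence, if y solves the delay equation, so do t |-> y(t + p)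
  and t |-> h^-k y(t + k theta_h); for the latter one also needs that h^-k commutes with the
  delay term h y(t - theta_h). As the delay equation is uniquely solvable, U(p,0)^m phi is the
  segment y_(mp) and U_h^n phi = h^-n y_(n theta_h), and n theta_h = m p.
*)

section \<open>Differential inequalities and uniqueness for ODEs\<close>

lemma norm_diff_le_of_vector_derivative_bound:
  fixes f :: "real \<Rightarrow> 'a::real_normed_vector"
  assumes "s \<le> t"
    and "\<And>r. r \<in> {s..t} \<Longrightarrow> (f has_vector_derivative f' r) (at r within {s..t})"
    and "\<And>r. r \<in> {s..t} \<Longrightarrow> norm (f' r) \<le> B"
  shows "norm (f t - f s) \<le> B * (t - s)"
proof -
  have "norm (f t - f s) \<le> B * norm (t - s)"
  proof (rule differentiable_bound[where S="{s..t}" and f'="\<lambda>r d. d *\<^sub>R f' r"])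
    show "onorm (\<lambda>d. d *\<^sub>R f' r) \<le> B" if "r \<in> {s..t}" for r
      using assms(3)[OF that] by (intro onorm_le) (simp add: mult.commute[of B] mult_left_mono)
  qed (use assms in \<open>auto simp: has_vector_derivative_def\<close>)
  then show ?thesis
    using assms(1) by simp
qed

(* The maximum M of |e| on [t0, t0 + d] satisfies M <= 2 C d M. *)
lemma delay_differential_inequality_step:
  fixes e e' :: "real \<Rightarrow> 'a::real_normed_vector"
  assumes "0 \<le> C" "0 < d" "2 * C * d < 1" "l \<le> t0 - th" "0 \<le> th"
    and cont: "continuous_on {t0..t0+d} e"
    and der: "\<And>t. t \<in> {t0..t0+d} \<Longrightarrow> (e has_vector_derivative e' t) (at t within {t0..t0+d})"
    and bound: "\<And>t. t \<in> {t0..t0+d} \<Longrightarrow> norm (e' t) \<le> C * (norm (e t) + norm (e (t - th)))"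
    and zero: "\<And>r. r \<in> {l..t0} \<Longrightarrow> e r = 0"
  shows "\<And>r. r \<in> {l..t0+d} \<Longrightarrow> e r = 0"
proof -
  have "continuous_on {t0..t0+d} (\<lambda>t. norm (e t))"
    using cont by (intro continuous_intros)
  then obtain s where s: "s \<in> {t0..t0+d}" and smax: "\<And>t. t \<in> {t0..t0+d} \<Longrightarrow> norm (e t) \<le> norm (e s)"
    using continuous_attains_sup[of "{t0..t0+d}" "\<lambda>t. norm (e t)"] \<open>0 < d\<close> by auto
  define M where "M = norm (e s)"
  have M_bound: "norm (e r) \<le> M" if "r \<in> {l..t0+d}" for r
    using that smax zero[of r] by (cases "r \<le> t0") (auto simp: M_def)
  have "norm (e t) \<le> 2 * C * M * d" if t: "t \<in> {t0..t0+d}" for t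
  proof -
    have "norm (e t - e t0) \<le> (2 * C * M) * (t - t0)"
    proof (rule norm_diff_le_of_vector_derivative_bound)
      fix r assume r: "r \<in> {t0..t}"
      with t show "(e has_vector_derivative e' r) (at r within {t0..t})"
        by (auto intro: has_vector_derivative_within_subset[OF der])
      have "norm (e' r) \<le> C * (norm (e r) + norm (e (r - th)))"
        using r t by (intro bound) auto
      also have "\<dots> \<le> C * (M + M)"
        using r t assms by (intro mult_left_mono add_mono M_bound) auto
      finally show "norm (e' r) \<le> 2 * C * M" by simp
    qed (use t in auto)
    also have "\<dots> \<le> (2 * C * M) * d"
      using t assms by (intro mult_left_mono) (auto simp: M_def)
    finally show ?thesis
      using zero[of t0] assms by simp
  qed
  then have "M \<le> (2 * C * d) * M"
    using s by (simp add: M_def mult_ac)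
  then have "(1 - 2 * C * d) * M \<le> 0"
    by (simp add: algebra_simps)
  then have "M \<le> 0"
    using assms(3) by (simp add: mult_le_0_iff)
  then show "\<And>r. r \<in> {l..t0+d} \<Longrightarrow> e r = 0"
    using M_bound by (metis norm_le_zero_iff order_trans)
qed

lemma delay_differential_inequality_imp_zero:
  fixes e e' :: "real \<Rightarrow> 'a::real_normed_vector"
  assumes "0 \<le> C" "0 \<le> th"
    and cont: "continuous_on {a..} e"
    and der: "\<And>t. a \<le> t \<Longrightarrow> (e has_vector_derivative e' t) (at t within {a..})"
    and bound: "\<And>t. a \<le> t \<Longrightarrow> norm (e' t) \<le> C * (norm (e t) + norm (e (t - th)))"
    and zero: "\<And>r. r \<in> {a-th..a} \<Longrightarrow> e r = 0"
    and "a \<le> t"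
  shows "e t = 0"
proof -
  define d where "d = 1 / (2 * C + 2)"
  have d: "0 < d" "2 * C * d < 1"
    using \<open>0 \<le> C\<close> by (auto simp: d_def field_simps)
  have "e r = 0" if "r \<in> {a-th..a + real k * d}" for k r
    using that
  proof (induction k arbitrary: r)
    case 0
    then show ?case using zero by simp
  next
    case (Suc k)
    let ?t0 = "a + real k * d"
    have "0 \<le> real k * d"
      using d by simp
    then have above_a: "a \<le> t" if "t \<in> {?t0..?t0+d}" for t
      using that unfolding atLeastAtMost_iff by linarith
    have "e r = 0" if "r \<in> {a-th..?t0+d}"
    proof (rule delay_differential_inequality_step[OF \<open>0 \<le> C\<close> d _ \<open>0 \<le> th\<close>, of "a - th" ?t0])
      show "continuous_on {?t0..?t0+d} e"
        by (rule continuous_on_subset[OF cont]) (use above_a in auto)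
      show "(e has_vector_derivative e' t) (at t within {?t0..?t0+d})" if "t \<in> {?t0..?t0+d}" for t
        by (rule has_vector_derivative_within_subset[OF der]) (use that above_a in auto)
      show "norm (e' t) \<le> C * (norm (e t) + norm (e (t - th)))" if "t \<in> {?t0..?t0+d}" for t
        using that above_a by (intro bound) auto
    qed (use Suc.IH that d in simp_all)
    then show ?case
      using Suc.prems by (simp add: algebra_simps)
  qed
  moreover obtain k :: nat where "(t - a) / d \<le> real k"
    using real_arch_simple by blast
  then have "t \<le> a + real k * d"
    using d by (simp add: field_simps)
  ultimately show ?thesis
    using \<open>a \<le> t\<close> \<open>0 \<le> th\<close> by auto
qed

lemma linear_derivative_bound_imp_zero:
  fixes e e' :: "real \<Rightarrow> 'a::real_normed_vector"
  assumes "0 \<le> C"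
    and "\<And>t. (e has_vector_derivative e' t) (at t)"
    and "\<And>t. norm (e' t) \<le> C * norm (e t)"
    and "e 0 = 0"
  shows "e t = 0"
proof -
  have forward: "e t = 0" if "0 \<le> t"
    and "\<And>t. (e has_vector_derivative e' t) (at t)" "\<And>t. norm (e' t) \<le> C * norm (e t)" "e 0 = 0"
    for e e' :: "real \<Rightarrow> 'a" and t
  proof (rule delay_differential_inequality_imp_zero[where th=0 and a=0 and C=C and e'=e'])
    show "continuous_on {0..} e"
      using that(2) by (meson continuous_at_imp_continuous_on has_vector_derivative_continuous)
    show "norm (e' t) \<le> C * (norm (e t) + norm (e (t - 0)))" for t
    proof -
      have "C * norm (e t) \<le> C * (norm (e t) + norm (e (t - 0)))"
        using \<open>0 \<le> C\<close> by (intro mult_left_mono) auto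
      then show ?thesis
        using that(3)[of t] by linarith
    qed
  qed (use that \<open>0 \<le> C\<close> in \<open>auto intro: has_vector_derivative_at_within\<close>)
  have "e (- t) = 0" if "0 \<le> t" for t
  proof (rule forward[where e="\<lambda>t. e (- t)" and e'="\<lambda>t. - e' (- t)", OF that])
    show "((\<lambda>t. e (- t)) has_vector_derivative - e' (- t)) (at t)" for t
      using vector_diff_chain_at[OF has_vector_derivative_minus[OF has_vector_derivative_id] assms(2)]
      by (simp add: o_def)
  qed (use assms in auto)
  then show ?thesis
    using forward[OF _ assms(2-4)] by (metis minus_minus neg_0_le_iff_le linorder_le_cases)
qed

lemma ode_solutions_eq:
  assumes x1: "\<And>t. (x1 has_vector_derivative f (x1 t)) (at t)"
    and x2: "\<And>t. (x2 has_vector_derivative f (x2 t)) (at t)"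
    and lipschitz: "C-lipschitz_on S f" and "range x1 \<subseteq> S" "range x2 \<subseteq> S"
    and "x1 0 = x2 0"
  shows "x1 = x2"
proof
  fix t
  have "x1 t - x2 t = 0"
  proof (rule linear_derivative_bound_imp_zero[where e="\<lambda>t. x1 t - x2 t"])
    show "((\<lambda>t. x1 t - x2 t) has_vector_derivative f (x1 t) - f (x2 t)) (at t)" for t
      using x1 x2 by (rule has_vector_derivative_diff)
    show "norm (f (x1 t) - f (x2 t)) \<le> C * norm (x1 t - x2 t)" for t
      using assms by (intro lipschitz_on_normD[OF lipschitz]) auto
  qed (use lipschitz_on_nonneg[OF lipschitz] \<open>x1 0 = x2 0\<close> in auto)
  then show "x1 t = x2 t"
    by simp
qed

lemma continuous_derivative_imp_lipschitz_on:
  fixes f :: "'a::euclidean_space \<Rightarrow> 'b::real_normed_vector"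
  assumes "\<And>z. (f has_derivative blinfun_apply (Df z)) (at z)" "continuous_on UNIV Df"
    and "compact S" "convex S"
  shows "\<exists>C. C-lipschitz_on S f"
proof -
  obtain B where B: "\<And>z. z \<in> S \<Longrightarrow> norm (Df z) \<le> B"
    using compact_imp_bounded[OF compact_continuous_image[OF continuous_on_subset[OF assms(2)] assms(3)]]
    unfolding bounded_iff by blast
  have "(max 0 B)-lipschitz_on S f"
    by (rule bounded_derivative_imp_lipschitz[OF has_derivative_at_withinI[OF assms(1)] \<open>convex S\<close>])
      (use B in \<open>auto simp: norm_blinfun.rep_eq[symmetric] intro: le_max_iff_disj[THEN iffD2]\<close>)
  then show ?thesis
    by blast
qed

lemma norm_integral_le_exp:
  fixes g :: "real \<Rightarrow> 'a::banach"
  assumes "continuous_on {0..t} g" "0 \<le> t" "0 < K"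
    and bound: "\<And>r. r \<in> {0..t} \<Longrightarrow> norm (g r) \<le> B * exp (K * r)"
  shows "norm (integral {0..t} g) \<le> B * exp (K * t) / K"
proof -
  have "norm (g 0) \<le> B"
    using bound[of 0] \<open>0 \<le> t\<close> by simp
  then have "0 \<le> B"
    by (rule order_trans[OF norm_ge_zero])
  have antiderivative: "((\<lambda>r. B * exp (K * r) / K) has_vector_derivative B * exp (K * r)) (at r within {0..t})"
    for r
    using \<open>0 < K\<close> by (auto intro!: derivative_eq_intros simp: has_real_derivative_iff_has_vector_derivative[symmetric])
  have "norm (integral {0..t} g) \<le> integral {0..t} (\<lambda>r. B * exp (K * r))"
    using assms by (intro integral_norm_bound_integral) (auto intro!: integrable_continuous_interval continuous_intros)
  also have "\<dots> = B * exp (K * t) / K - B / K"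
    using integral_unique[OF fundamental_theorem_of_calculus[OF \<open>0 \<le> t\<close> antiderivative]] by simp
  also have "\<dots> \<le> B * exp (K * t) / K"
    using \<open>0 \<le> B\<close> \<open>0 < K\<close> by simp
  finally show ?thesis .
qed

lemma integral_has_vector_derivative_atLeast:
  fixes f :: "real \<Rightarrow> 'a::banach"
  assumes "continuous_on {a..} f" "a \<le> t"
  shows "((\<lambda>u. integral {a..u} f) has_vector_derivative f t) (at t within {a..})"
proof -
  have "((\<lambda>u. integral {a..u} f) has_vector_derivative f t) (at t within {a..t+1})"
    using assms by (intro integral_has_vector_derivative continuous_on_subset[OF assms(1)]) auto
  moreover have "at t within {a..t+1} = at t within {a..}"
    by (rule at_within_nhd[where S="{..<t+1}"]) auto
  ultimately show ?thesis
    by simp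
qed

section \<open>Periodic functions\<close>

lemma periodic_of_int:
  fixes x :: "real \<Rightarrow> 'a"
  assumes "\<And>t. x (t + p) = x t"
  shows "x (t + of_int k * p) = x t"
proof -
  have nat_shift: "x (t + real j * p) = x t" for t j
  proof (induction j)
    case (Suc j)
    have "x (t + real (Suc j) * p) = x ((t + real j * p) + p)"
      by (simp add: algebra_simps)
    then show ?case
      using assms Suc by simp
  qed simp
  show ?thesis
  proof (cases "0 \<le> k")
    case True
    then show ?thesis
      using nat_shift[of t "nat k"] by simp
  next
    case False
    then show ?thesis
      using nat_shift[of "t + of_int k * p" "nat (- k)"] by simp
  qed
qed

lemma periodic_value_in_period:
  fixes x :: "real \<Rightarrow> 'a"
  assumes "\<And>t. x (t + p) = x t" "0 < p"
  shows "\<exists>s. 0 \<le> s \<and> s < p \<and> x s = x t"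
proof (intro exI conjI)
  define k where "k = \<lfloor>t / p\<rfloor>"
  show "0 \<le> t - of_int k * p" "t - of_int k * p < p"
    using \<open>0 < p\<close> floor_divide_lower[of p t] floor_divide_upper[of p t] by (simp_all add: k_def distrib_right)
  show "x (t - of_int k * p) = x t"
    using periodic_of_int[of x p, OF assms(1), of "t - of_int k * p" k] by simp
qed

lemma periodic_compact_range:
  fixes x :: "real \<Rightarrow> 'a::topological_space"
  assumes "\<And>t. x (t + p) = x t" "0 < p" "continuous_on UNIV x"
  shows "compact (range x)"
proof -
  have "range x \<subseteq> x ` {0..p}"
  proof
    fix z assume "z \<in> range x"
    then obtain t where "z = x t"
      by blast
    moreover obtain s where "0 \<le> s" "s < p" "x s = x t"
      using periodic_value_in_period[of x p, OF assms(1,2)] by blast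
    ultimately show "z \<in> x ` {0..p}"
      by (metis atLeastAtMost_iff image_eqI less_imp_le)
  qed
  then have "range x = x ` {0..p}"
    by blast
  then show ?thesis
    using assms(3) by (metis compact_Icc compact_continuous_image continuous_on_subset subset_UNIV)
qed

lemma periodic_bounded:
  fixes g :: "real \<Rightarrow> 'a::real_normed_vector"
  assumes "\<And>t. g (t + p) = g t" "0 < p" "continuous_on UNIV g"
  shows "\<exists>B. \<forall>t. norm (g t) \<le> B"
  using compact_imp_bounded[OF periodic_compact_range[of g p, OF assms]] unfolding bounded_iff by blast

section \<open>Matrix powers\<close>

definition mat_pow :: "'a::semiring_1^'n^'n \<Rightarrow> nat \<Rightarrow> 'a^'n^'n" where
  "mat_pow M k = ((**) M ^^ k) (mat 1)"

lemma mat_pow_0 [simp]: "mat_pow M 0 = mat 1"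
  by (simp add: mat_pow_def)

lemma mat_pow_Suc: "mat_pow M (Suc k) = M ** mat_pow M k"
  by (simp add: mat_pow_def)

lemma mat_pow_Suc_right: "mat_pow M (Suc k) = mat_pow M k ** M"
  by (induction k) (simp_all add: mat_pow_Suc matrix_mul_assoc)

lemma mat_pow_mat_1 [simp]: "mat_pow (mat 1) k = mat 1"
  by (induction k) (simp_all add: mat_pow_Suc)

lemma mat_pow_commute:
  assumes "M ** N = N ** M"
  shows "mat_pow M k ** N = N ** mat_pow M k"
proof (induction k)
  case (Suc k)
  have "mat_pow M (Suc k) ** N = M ** (mat_pow M k ** N)"
    by (simp add: mat_pow_Suc matrix_mul_assoc)
  also have "\<dots> = (M ** N) ** mat_pow M k"
    by (simp add: Suc matrix_mul_assoc)
  also have "\<dots> = N ** mat_pow M (Suc k)"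
    by (simp add: assms mat_pow_Suc matrix_mul_assoc)
  finally show ?case .
qed simp

lemma mat_pow_inverse:
  assumes "A ** B = mat 1"
  shows "mat_pow A k ** mat_pow B k = mat 1"
proof (induction k)
  case (Suc k)
  have "mat_pow A (Suc k) ** mat_pow B (Suc k) = A ** (mat_pow A k ** mat_pow B k) ** B"
    unfolding mat_pow_Suc[of A] mat_pow_Suc_right[of B] by (simp add: matrix_mul_assoc)
  then show ?case
    by (simp add: Suc assms)
qed simp

lemma funpow_mat_act: "(mat_act M ^^ k) phi = mat_act (mat_pow M k) phi"
  by (induction k) (simp_all add: mat_act_def mat_pow_Suc matrix_vector_mul_assoc)

lemma orthogonal_matrix_inv:
  assumes "orthogonal_matrix h"
  shows "h ** matrix_inv h = mat 1" "matrix_inv h ** h = mat 1"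
proof -
  have "h ** matrix_inv h = mat 1 \<and> matrix_inv h ** h = mat 1"
    unfolding matrix_inv_def
    by (rule someI[of _ "transpose h"]) (use assms in \<open>simp add: orthogonal_matrix_def\<close>)
  then show "h ** matrix_inv h = mat 1" "matrix_inv h ** h = mat 1"
    by simp_all
qed

lemma mat_pow_shift_coefficient:
  fixes A :: "real \<Rightarrow> (real^'n) \<Rightarrow>\<^sub>L (real^'n)"
  assumes "\<And>r w. g *v A (r + T) w = A r (g *v w)"
  shows "mat_pow g k *v A (r + real k * T) w = A r (mat_pow g k *v w)"
proof (induction k arbitrary: r w)
  case (Suc k)
  have "mat_pow g (Suc k) *v A (r + real (Suc k) * T) w = g *v (mat_pow g k *v A ((r + T) + real k * T) w)"
    by (simp add: mat_pow_Suc matrix_vector_mul_assoc algebra_simps)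
  also have "\<dots> = g *v A (r + T) (mat_pow g k *v w)"
    by (simp only: Suc)
  also have "\<dots> = A r (mat_pow g (Suc k) *v w)"
    by (simp add: assms mat_pow_Suc matrix_vector_mul_assoc)
  finally show ?case .
qed simp

lemma derivative_equivariant:
  fixes f :: "real^'n \<Rightarrow> real^'n" and g :: "real^'n^'n"
  assumes deriv: "\<And>z. (f has_derivative blinfun_apply (Df z)) (at z)"
    and equiv: "\<And>z. f (g *v z) = g *v f z"
  shows "Df (g *v v) (g *v w) = g *v Df v w"
proof -
  have "((\<lambda>z. f (g *v z)) has_derivative (\<lambda>w. Df (g *v v) (g *v w))) (at v)"
    by (rule has_derivative_compose[OF bounded_linear_imp_has_derivative[OF matrix_vector_mul_bounded_linear] deriv])
  then have "((\<lambda>z. g *v f z) has_derivative (\<lambda>w. Df (g *v v) (g *v w))) (at v)"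
    by (simp add: equiv)
  moreover have "((\<lambda>z. g *v f z) has_derivative (\<lambda>w. g *v Df v w)) (at v)"
    by (rule bounded_linear.has_derivative[OF matrix_vector_mul_bounded_linear deriv])
  ultimately have "(\<lambda>w. Df (g *v v) (g *v w)) = (\<lambda>w. g *v Df v w)"
    by (rule has_derivative_unique)
  then show ?thesis
    by metis
qed

section \<open>The linear delay equation\<close>

locale linear_delay_equation =
  fixes Df :: "real^'n \<Rightarrow> (real^'n) \<Rightarrow>\<^sub>L (real^'n)" and x :: "real \<Rightarrow> real^'n"
    and b :: real and h :: "real^'n^'n" and th L :: real
  assumes coefficient_continuous: "continuous_on UNIV (\<lambda>t. Df (x t))"
    and norm_coefficient_le: "\<And>t. norm (Df (x t)) \<le> L"
    and delay_nonneg: "0 \<le> th"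
begin

definition delay_rhs :: "(real \<Rightarrow> real^'n) \<Rightarrow> real \<Rightarrow> real^'n" where
  "delay_rhs y t = Df (x t) (y t) + b *\<^sub>R (y t - h *v y (t - th))"

definition rhs_lipschitz :: real where
  "rhs_lipschitz = L + \<bar>b\<bar> + \<bar>b\<bar> * onorm ((*v) h)"

lemma dde_sol_iff:
  "dde_sol Df x b h th s phi y \<longleftrightarrow>
     continuous_on {s - th..} y \<and> (\<forall>r. r < s - th \<longrightarrow> y r = 0) \<and> (\<forall>v\<in>{-th..0}. y (s + v) = phi v) \<and>
     (\<forall>t\<ge>s. (y has_vector_derivative delay_rhs y t) (at t within {s..}))"
  by (simp add: dde_sol_def delay_rhs_def)

lemma rhs_lipschitz_nonneg: "0 \<le> rhs_lipschitz"
proof -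
  have "0 \<le> L"
    using norm_coefficient_le[of 0] norm_ge_zero order_trans by blast
  then show ?thesis
    by (simp add: rhs_lipschitz_def onorm_pos_le matrix_vector_mul_bounded_linear)
qed

lemma delay_rhs_diff: "delay_rhs (\<lambda>r. y1 r - y2 r) t = delay_rhs y1 t - delay_rhs y2 t"
  by (simp add: delay_rhs_def blinfun.diff_right matrix_vector_mult_diff_distrib algebra_simps)

lemma norm_delay_rhs_le:
  assumes "norm (y t) \<le> N" "norm (y (t - th)) \<le> N"
  shows "norm (delay_rhs y t) \<le> rhs_lipschitz * N"
proof -
  have "norm (Df (x t) (y t)) \<le> L * N"
    using assms(1) norm_coefficient_le[of t]
    by (meson mult_mono norm_blinfun norm_ge_zero order_trans)
  moreover have "norm (h *v y (t - th)) \<le> onorm ((*v) h) * N"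
    using onorm[OF matrix_vector_mul_bounded_linear, of h "y (t - th)"] assms(2)
      onorm_pos_le[OF matrix_vector_mul_bounded_linear, of h]
    by (meson mult_left_mono order_trans)
  ultimately have "norm (Df (x t) (y t)) + \<bar>b\<bar> * (norm (y t) + norm (h *v y (t - th)))
      \<le> L * N + \<bar>b\<bar> * (N + onorm ((*v) h) * N)"
    using assms(1) by (intro add_mono mult_left_mono) auto
  moreover have "norm (delay_rhs y t) \<le> norm (Df (x t) (y t)) + \<bar>b\<bar> * (norm (y t) + norm (h *v y (t - th)))"
    unfolding delay_rhs_def
    by (rule order_trans[OF norm_triangle_ineq]) (simp add: mult_left_mono norm_triangle_ineq4)
  ultimately have "norm (delay_rhs y t) \<le> L * N + \<bar>b\<bar> * (N + onorm ((*v) h) * N)"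
    by linarith
  then show ?thesis
    by (simp add: rhs_lipschitz_def algebra_simps)
qed

lemma dde_sol_unique:
  assumes y1: "dde_sol Df x b h th s phi y1" and y2: "dde_sol Df x b h th s phi y2"
  shows "y1 = y2"
proof
  fix t
  define e where "e r = y1 r - y2 r" for r
  have history: "e r = 0" if "r \<le> s" for r
  proof (cases "r < s - th")
    case True
    then show ?thesis
      using y1 y2 by (simp add: dde_sol_def e_def)
  next
    case False
    then have "r - s \<in> {-th..0}"
      using that by simp
    then have "y1 (s + (r - s)) = phi (r - s)" "y2 (s + (r - s)) = phi (r - s)"
      using y1 y2 unfolding dde_sol_def by blast+
    then show ?thesis
      by (simp add: e_def)
  qed
  have "e t = 0" if "s \<le> t"
  proof (rule delay_differential_inequality_imp_zero[OF rhs_lipschitz_nonneg delay_nonneg _ _ _ _ that])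
    show "continuous_on {s..} e"
      using y1 y2 delay_nonneg unfolding dde_sol_def e_def
      by (intro continuous_intros) (auto intro: continuous_on_subset)
    show "(e has_vector_derivative delay_rhs e r) (at r within {s..})" if "s \<le> r" for r
      using y1 y2 that unfolding dde_sol_iff e_def delay_rhs_diff
      by (intro has_vector_derivative_diff) auto
    show "norm (delay_rhs e r) \<le> rhs_lipschitz * (norm (e r) + norm (e (r - th)))" for r
      by (rule norm_delay_rhs_le) auto
  qed (use history in auto)
  then show "y1 t = y2 t"
    using history[of t] by (cases "s \<le> t") (auto simp: e_def)
qed

end

(*
  Existence by a fixed point argument: solutions are sought as y(t) = exp(rate t) u(t) with u
  bounded and continuous; in this weighted form the integral equation is a contraction with
  constant rhs_lipschitz / rate <= 1/2 on the whole half-line. The history part of trial u is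
  shifted by u 0 - phi 0 so that trial u is continuous for every u; fixed points have u 0 = phi 0.
*)
locale delay_picard = linear_delay_equation Df x b h th L
  for Df :: "real^'n \<Rightarrow> (real^'n) \<Rightarrow>\<^sub>L (real^'n)" and x b h th L +
  fixes phi :: "real \<Rightarrow> real^'n"
  assumes history_continuous: "continuous_on {-th..0} phi"
begin

definition rate :: real where
  "rate = 2 * rhs_lipschitz + 1"

definition trial :: "(real \<Rightarrow>\<^sub>C (real^'n)) \<Rightarrow> real \<Rightarrow> real^'n" where
  "trial u r =
     (if r < -th then 0 else if r \<le> 0 then phi r - phi 0 + u 0 else exp (rate * r) *\<^sub>R u r)"

definition picard :: "(real \<Rightarrow>\<^sub>C (real^'n)) \<Rightarrow> real \<Rightarrow> real^'n" where
  "picard u t =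
     exp (- (rate * max 0 t)) *\<^sub>R (phi 0 + integral {0..max 0 t} (delay_rhs (trial u)))"

lemma rate_pos: "0 < rate"
  using rhs_lipschitz_nonneg by (simp add: rate_def)

lemma trial_continuous: "continuous_on {-th..} (trial u)"
proof -
  have "continuous_on {-th..}
      (\<lambda>r. if r \<le> 0 then phi r - phi 0 + u 0 else exp (rate * r) *\<^sub>R u r)"
  proof (rule continuous_on_cases_1)
    have "{r \<in> {-th..}. r \<le> 0} = {-th..0}"
      by auto
    then show "continuous_on {r \<in> {-th..}. r \<le> 0} (\<lambda>r. phi r - phi 0 + u 0)"
      using history_continuous by (auto intro!: continuous_intros)
  qed (auto intro!: continuous_intros)
  then show ?thesis
    by (rule continuous_on_eq) (simp add: trial_def)
qed

lemma delay_rhs_trial_continuous: "continuous_on {0..} (delay_rhs (trial u))"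
proof -
  have "continuous_on {0..} (\<lambda>r. trial u (r - th))"
    by (rule continuous_on_compose2[OF trial_continuous]) (auto intro!: continuous_intros)
  then have "continuous_on {0..} (\<lambda>r. h *v trial u (r - th))"
    by (rule bounded_linear.continuous_on[OF matrix_vector_mul_bounded_linear])
  moreover have "continuous_on {0..} (trial u)"
    by (rule continuous_on_subset[OF trial_continuous]) (use delay_nonneg in auto)
  ultimately show ?thesis
    unfolding delay_rhs_def[abs_def]
    by (intro continuous_intros continuous_on_subset[OF coefficient_continuous]) auto
qed

lemma norm_trial_diff_le:
  assumes "-th \<le> r"
  shows "norm (trial u1 r - trial u2 r) \<le> dist u1 u2 * exp (rate * max 0 r)"
proof (cases "r \<le> 0")
  case True
  then show ?thesis
    using assms dist_bounded[of u1 0 u2] by (simp add: trial_def dist_norm)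
next
  case False
  then have "norm (trial u1 r - trial u2 r) = exp (rate * r) * dist (u1 r) (u2 r)"
    using assms by (simp add: trial_def dist_norm flip: scaleR_diff_right)
  then show ?thesis
    using False dist_bounded[of u1 r u2] by (simp add: mult.commute)
qed

lemma norm_trial_le:
  assumes phi_bound: "\<And>v. v \<in> {-th..0} \<Longrightarrow> norm (phi v) \<le> M" and "-th \<le> r"
  shows "norm (trial u r) \<le> (norm u + 2 * M) * exp (rate * max 0 r)"
proof (cases "r \<le> 0")
  case True
  have "norm (phi r - phi 0 + u 0) \<le> norm (phi r - phi 0) + norm (u 0)"
    by (rule norm_triangle_ineq)
  also have "\<dots> \<le> norm (phi r) + norm (phi 0) + norm u"
    using norm_triangle_ineq4[of "phi r" "phi 0"] norm_bounded[of u 0] by linarith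
  also have "\<dots> \<le> norm u + 2 * M"
    using phi_bound[of r] phi_bound[of 0] True assms(2) delay_nonneg by simp
  finally show ?thesis
    using True assms(2) by (simp add: trial_def)
next
  case False
  have "norm (phi 0) \<le> M"
    using delay_nonneg by (intro phi_bound) auto
  then have "norm (u r) \<le> norm u + 2 * M"
    using norm_bounded[of u r] norm_ge_zero[of "phi 0"] by linarith
  then have "exp (rate * r) * norm (u r) \<le> exp (rate * r) * (norm u + 2 * M)"
    by (rule mult_left_mono) simp
  then show ?thesis
    using False delay_nonneg by (simp add: trial_def mult.commute)
qed

lemma norm_integral_delay_rhs_le:
  assumes "continuous_on {0..} (delay_rhs y)" "0 \<le> t"
    and y_bound: "\<And>r. -th \<le> r \<Longrightarrow> norm (y r) \<le> B * exp (rate * max 0 r)"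
  shows "norm (integral {0..t} (delay_rhs y)) \<le> rhs_lipschitz * B * exp (rate * t) / rate"
proof (rule norm_integral_le_exp[OF continuous_on_subset[OF assms(1)] \<open>0 \<le> t\<close> rate_pos])
  fix r assume r: "r \<in> {0..t}"
  have "norm (y 0) \<le> B"
    using y_bound[of 0] delay_nonneg by simp
  then have "0 \<le> B"
    by (rule order_trans[OF norm_ge_zero])
  have "norm (y r) \<le> B * exp (rate * r)"
    using y_bound[of r] r delay_nonneg by simp
  moreover have "norm (y (r - th)) \<le> B * exp (rate * max 0 (r - th))"
    using r by (intro y_bound) simp
  moreover have "B * exp (rate * max 0 (r - th)) \<le> B * exp (rate * r)"
    using r delay_nonneg rate_pos \<open>0 \<le> B\<close> by (intro mult_left_mono) auto
  ultimately have "norm (delay_rhs y r) \<le> rhs_lipschitz * (B * exp (rate * r))"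
    by (intro norm_delay_rhs_le) auto
  then show "norm (delay_rhs y r) \<le> rhs_lipschitz * B * exp (rate * r)"
    by (simp only: mult.assoc)
qed auto

lemma norm_picard_diff_le: "norm (picard u1 t - picard u2 t) \<le> dist u1 u2 / 2"
proof -
  define s where "s = max 0 t"
  define D where "D = dist u1 u2"
  have "0 \<le> s" "0 \<le> D"
    by (simp_all add: s_def D_def)
  have rhs_eq: "delay_rhs (\<lambda>r. trial u1 r - trial u2 r) = (\<lambda>r. delay_rhs (trial u1) r - delay_rhs (trial u2) r)"
    by (rule ext) (rule delay_rhs_diff)
  have integrable: "delay_rhs (trial u) integrable_on {0..s}" for u
    by (rule integrable_continuous_interval[OF continuous_on_subset[OF delay_rhs_trial_continuous]]) auto
  have "picard u1 t - picard u2 t =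
      exp (- (rate * s)) *\<^sub>R integral {0..s} (delay_rhs (\<lambda>r. trial u1 r - trial u2 r))"
    unfolding rhs_eq integral_diff[OF integrable integrable]
    by (simp add: picard_def s_def flip: scaleR_diff_right)
  then have "norm (picard u1 t - picard u2 t) =
      exp (- (rate * s)) * norm (integral {0..s} (delay_rhs (\<lambda>r. trial u1 r - trial u2 r)))"
    by simp
  also have "\<dots> \<le> exp (- (rate * s)) * (rhs_lipschitz * D * exp (rate * s) / rate)"
    unfolding D_def
    by (intro mult_left_mono norm_integral_delay_rhs_le[OF _ \<open>0 \<le> s\<close> norm_trial_diff_le])
      (auto simp: rhs_eq intro!: continuous_intros delay_rhs_trial_continuous)
  also have "\<dots> = rhs_lipschitz * D / rate"
    by (simp add: exp_minus field_simps)
  also have "\<dots> \<le> D / 2"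
    using rhs_lipschitz_nonneg \<open>0 \<le> D\<close> rate_pos by (simp add: rate_def field_simps)
  finally show ?thesis
    by (simp add: D_def)
qed

lemma picard_continuous: "continuous_on UNIV (picard u)"
proof -
  have "continuous_on {0..} (\<lambda>s. integral {0..s} (delay_rhs (trial u)))"
    using integral_has_vector_derivative_atLeast[OF delay_rhs_trial_continuous]
    by (auto simp: continuous_on_eq_continuous_within intro: has_vector_derivative_continuous)
  then have "continuous_on UNIV (\<lambda>t. integral {0..max 0 t} (delay_rhs (trial u)))"
    by (rule continuous_on_compose2) (auto intro!: continuous_intros)
  then show ?thesis
    unfolding picard_def[abs_def] by (intro continuous_intros)
qed

lemma norm_picard_bounded: "\<exists>B. \<forall>t. norm (picard u t) \<le> B"
proof -
  obtain M where M: "\<And>v. v \<in> {-th..0} \<Longrightarrow> norm (phi v) \<le> M"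
    using compact_imp_bounded[OF compact_continuous_image[OF history_continuous compact_Icc]]
    unfolding bounded_iff by (metis image_eqI)
  have "norm (picard u t) \<le> norm (phi 0) + rhs_lipschitz * (norm u + 2 * M) / rate" for t
  proof -
    define s where "s = max 0 t"
    have "0 \<le> s"
      by (simp add: s_def)
    have "norm (integral {0..s} (delay_rhs (trial u))) \<le> rhs_lipschitz * (norm u + 2 * M) * exp (rate * s) / rate"
      by (rule norm_integral_delay_rhs_le[OF delay_rhs_trial_continuous \<open>0 \<le> s\<close> norm_trial_le[OF M]])
    then have "norm (picard u t) \<le> exp (- (rate * s)) * (norm (phi 0) + rhs_lipschitz * (norm u + 2 * M) * exp (rate * s) / rate)"
      unfolding picard_def s_def[symmetric]
      by (auto intro!: mult_left_mono order_trans[OF norm_triangle_ineq])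
    also have "\<dots> = exp (- (rate * s)) * norm (phi 0) + rhs_lipschitz * (norm u + 2 * M) / rate"
      by (simp add: exp_minus field_simps)
    also have "\<dots> \<le> norm (phi 0) + rhs_lipschitz * (norm u + 2 * M) / rate"
      using \<open>0 \<le> s\<close> rate_pos by (simp add: mult_left_le_one_le)
    finally show ?thesis .
  qed
  then show ?thesis
    by blast
qed

lemma apply_Bcontfun_picard: "apply_bcontfun (Bcontfun (picard u)) = picard u"
  using norm_picard_bounded[of u]
  by (auto intro!: Bcontfun_inverse bcontfun_normI picard_continuous)

lemma picard_fixed_point: "\<exists>u. \<forall>t. apply_bcontfun u t = picard u t"
proof -
  have "dist (Bcontfun (picard u1)) (Bcontfun (picard u2)) \<le> 1/2 * dist u1 u2" for u1 u2
    using norm_picard_diff_le by (intro dist_bound) (simp add: apply_Bcontfun_picard dist_norm)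
  then obtain u where "Bcontfun (picard u) = u"
    using banach_fix_type[of "1/2" "\<lambda>u. Bcontfun (picard u)"] by auto
  then show ?thesis
    by (metis apply_Bcontfun_picard)
qed

lemma dde_sol_exists: "\<exists>y. dde_sol Df x b h th 0 phi y"
proof -
  obtain u where u: "\<And>t. apply_bcontfun u t = picard u t"
    using picard_fixed_point by blast
  have "u 0 = phi 0"
    using u[of 0] by (simp add: picard_def)
  have integral_eq: "trial u t = phi 0 + integral {0..t} (delay_rhs (trial u))" if "0 \<le> t" for t
  proof (cases "t = 0")
    case True
    then show ?thesis
      using \<open>u 0 = phi 0\<close> delay_nonneg by (simp add: trial_def)
  next
    case False
    then show ?thesis
      using that u[of t] delay_nonneg by (simp add: trial_def picard_def exp_minus)
  qed
  have "(trial u has_vector_derivative delay_rhs (trial u) t) (at t within {0..})" if "0 \<le> t" for t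
  proof (rule has_vector_derivative_transform[OF _ integral_eq])
    show "((\<lambda>t. phi 0 + integral {0..t} (delay_rhs (trial u))) has_vector_derivative delay_rhs (trial u) t)
        (at t within {0..})"
      using integral_has_vector_derivative_atLeast[OF delay_rhs_trial_continuous that]
      by (auto intro!: derivative_eq_intros)
  qed (use that in auto)
  moreover have "\<forall>v\<in>{-th..0}. trial u (0 + v) = phi v"
    using \<open>u 0 = phi 0\<close> by (simp add: trial_def)
  moreover have "\<forall>r. r < 0 - th \<longrightarrow> trial u r = 0"
    by (simp add: trial_def)
  ultimately have "dde_sol Df x b h th 0 phi (trial u)"
    unfolding dde_sol_iff using trial_continuous[of u] by simp
  then show ?thesis
    by blast
qed

end

(* The segment g y_s on [-th, 0], extended by 0 like the elements of Cspace. *)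
definition twisted_seg :: "real \<Rightarrow> (real \<Rightarrow> real^'n) \<Rightarrow> real \<Rightarrow> real^'n^'n \<Rightarrow> real \<Rightarrow> real^'n" where
  "twisted_seg th y s g = (\<lambda>v. if v \<in> {-th..0} then g *v y (s + v) else 0)"

lemma mat_act_twisted_seg: "mat_act M (twisted_seg th y s g) = twisted_seg th y s (M ** g)"
  by (auto simp: mat_act_def twisted_seg_def matrix_vector_mul_assoc)

context linear_delay_equation
begin

lemma dde_sol_exists_history:
  assumes "continuous_on {-th..0} phi"
  shows "\<exists>y. dde_sol Df x b h th 0 phi y"
proof -
  interpret delay_picard Df x b h th L phi
    by unfold_locales (rule assms)
  show ?thesis
    by (rule dde_sol_exists)
qed

lemma solop_eq_twisted_seg:
  assumes "dde_sol Df x b h th 0 phi y"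
  shows "solop Df x b h th t 0 phi = twisted_seg th y t (mat 1)"
proof -
  have the_eq: "(THE y. dde_sol Df x b h th 0 phi y) = y"
    using assms dde_sol_unique by blast
  show ?thesis
    unfolding solop_def Let_def the_eq by (simp add: twisted_seg_def cong: if_cong)
qed

lemma dde_sol_twisted_shift:
  assumes y: "dde_sol Df x b h th 0 phi y" and "0 \<le> sg"
    and commute: "g ** h = h ** g"
    and coefficient_shift: "\<And>r w. g *v Df (x (r + sg)) w = Df (x r) (g *v w)"
  shows "dde_sol Df x b h th 0 (twisted_seg th y sg g) (\<lambda>r. if r < -th then 0 else g *v y (r + sg))"
    (is "dde_sol _ _ _ _ _ _ _ ?z")
proof -
  have y_cont: "continuous_on {-th..} y" and
    y_deriv: "\<And>t. 0 \<le> t \<Longrightarrow> (y has_vector_derivative delay_rhs y t) (at t within {0..})"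
    using y by (simp_all add: dde_sol_iff)
  have "continuous_on {-th..} (\<lambda>r. y (r + sg))"
    by (rule continuous_on_compose2[OF y_cont]) (use \<open>0 \<le> sg\<close> in \<open>auto intro!: continuous_intros\<close>)
  then have "continuous_on {-th..} (\<lambda>r. g *v y (r + sg))"
    by (rule bounded_linear.continuous_on[OF matrix_vector_mul_bounded_linear])
  then have "continuous_on {-th..} ?z"
    by (rule continuous_on_eq) auto
  moreover have "(?z has_vector_derivative delay_rhs ?z r) (at r within {0..})" if "0 \<le> r" for r
  proof -
    have "(y has_vector_derivative delay_rhs y (r + sg)) (at (r + sg) within (\<lambda>r. r + sg) ` {0..})"
      using y_deriv[of "r + sg"] that \<open>0 \<le> sg\<close>
      by (auto intro: has_vector_derivative_within_subset)
    moreover have "((\<lambda>r. r + sg) has_vector_derivative 1) (at r within {0..})"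
      by (auto intro!: derivative_eq_intros)
    ultimately have "((y \<circ> (\<lambda>r. r + sg)) has_vector_derivative 1 *\<^sub>R delay_rhs y (r + sg)) (at r within {0..})"
      using vector_diff_chain_within by blast
    then have "((\<lambda>r. y (r + sg)) has_vector_derivative delay_rhs y (r + sg)) (at r within {0..})"
      by (simp add: o_def)
    from bounded_linear.has_vector_derivative[OF matrix_vector_mul_bounded_linear this, of g]
    have deriv: "((\<lambda>r. g *v y (r + sg)) has_vector_derivative g *v delay_rhs y (r + sg)) (at r within {0..})" .
    have rhs_eq: "g *v delay_rhs y (r + sg) = delay_rhs ?z r"
      using that delay_nonneg
      by (simp add: delay_rhs_def matrix_vector_right_distrib matrix_vector_mult_scaleR
          matrix_vector_mult_diff_distrib coefficient_shift algebra_simps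
          matrix_vector_mul_assoc commute)
    show ?thesis
      by (rule has_vector_derivative_transform[OF _ _ deriv[unfolded rhs_eq]]) (use that delay_nonneg in auto)
  qed
  ultimately show ?thesis
    unfolding dde_sol_iff by (auto simp: twisted_seg_def add.commute)
qed

lemma solop_twisted_seg:
  assumes "dde_sol Df x b h th 0 phi y" "0 \<le> sg" "0 \<le> t"
    and "g ** h = h ** g" "\<And>r w. g *v Df (x (r + sg)) w = Df (x r) (g *v w)"
  shows "solop Df x b h th t 0 (twisted_seg th y sg g) = twisted_seg th y (t + sg) g"
  using solop_eq_twisted_seg[OF dde_sol_twisted_shift[OF assms(1,2,4,5)], of t] assms(3)
  by (auto simp: twisted_seg_def algebra_simps)

lemma twisted_monodromy_iterate:
  assumes y: "dde_sol Df x b h th 0 phi y" and phi_zero: "\<And>v. v \<notin> {-th..0} \<Longrightarrow> phi v = 0"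
    and "0 \<le> T" and commute: "g ** h = h ** g"
    and shift: "\<And>r w. g *v Df (x (r + T)) w = Df (x r) (g *v w)"
  shows "((mat_act g \<circ> solop Df x b h th T 0) ^^ k) phi = twisted_seg th y (real k * T) (mat_pow g k)"
proof (induction k)
  case 0
  have "\<forall>v\<in>{-th..0}. y (0 + v) = phi v"
    using y by (simp add: dde_sol_def)
  then show ?case
    using phi_zero by (auto simp: twisted_seg_def)
next
  case (Suc k)
  have "solop Df x b h th T 0 (twisted_seg th y (real k * T) (mat_pow g k))
      = twisted_seg th y (T + real k * T) (mat_pow g k)"
    using mat_pow_shift_coefficient[of g "\<lambda>t. Df (x t)" T] shift \<open>0 \<le> T\<close>
    by (intro solop_twisted_seg[OF y] mat_pow_commute commute) auto
  then show ?case
    using Suc by (simp add: mat_act_twisted_seg mat_pow_Suc algebra_simps)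
qed

lemma monodromy_power_eq_twisted:
  assumes phi: "phi \<in> Cspace th"
    and periodic: "\<And>t. x (t + p) = x t" "0 \<le> p"
    and symmetry: "\<And>r w. Df (x (r + th)) (h *v w) = h *v Df (x r) w"
    and inverse: "h ** hi = mat 1" "hi ** h = mat 1"
    and "real n * th = real m * p"
  shows "(solop Df x b h th p 0 ^^ m) phi =
    (mat_act h ^^ n) (((mat_act hi \<circ> solop Df x b h th th 0) ^^ n) phi)"
proof -
  have phi_zero: "\<And>v. v \<notin> {-th..0} \<Longrightarrow> phi v = 0"
    using phi by (simp add: Cspace_def)
  obtain y where y: "dde_sol Df x b h th 0 phi y"
    using dde_sol_exists_history phi by (auto simp: Cspace_def)
  have "mat_act (mat 1) \<circ> solop Df x b h th p 0 = solop Df x b h th p 0"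
    by (auto simp: mat_act_def)
  then have power: "(solop Df x b h th p 0 ^^ m) phi = twisted_seg th y (real m * p) (mat 1)"
    using twisted_monodromy_iterate[OF y phi_zero \<open>0 \<le> p\<close>, of "mat 1" m] periodic by simp
  have "hi *v Df (x (r + th)) w = Df (x r) (hi *v w)" for r w
  proof -
    have "hi *v Df (x (r + th)) w = hi *v Df (x (r + th)) (h *v (hi *v w))"
      by (simp add: matrix_vector_mul_assoc inverse)
    also have "\<dots> = Df (x r) (hi *v w)"
      by (simp only: symmetry) (simp add: matrix_vector_mul_assoc inverse)
    finally show ?thesis .
  qed
  then have "((mat_act hi \<circ> solop Df x b h th th 0) ^^ n) phi = twisted_seg th y (real n * th) (mat_pow hi n)"
    using twisted_monodromy_iterate[OF y phi_zero delay_nonneg, of hi n] inverse by simp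
  then show ?thesis
    using power \<open>real n * th = real m * p\<close>
    by (simp add: funpow_mat_act mat_act_twisted_seg mat_pow_inverse[OF inverse(1)])
qed

end

section \<open>The spatio-temporal symmetry of the periodic orbit\<close>

lemma theta_eqI:
  assumes minper: "\<And>q. 0 < q \<Longrightarrow> q < p \<Longrightarrow> \<not> (\<forall>t. x (t + q) = x t)"
    and "0 \<le> \<tau>" "\<tau> < p" "\<And>t. h *v x t = x (t + \<tau>)"
  shows "theta p x h = \<tau>"
  unfolding theta_def
proof (rule the_equality)
  fix \<sigma> assume \<sigma>: "0 \<le> \<sigma> \<and> \<sigma> < p \<and> (\<forall>t. h *v x t = x (t + \<sigma>))"
  have shift_diff: "x (t + (b - a)) = x t"
    if "\<forall>t. h *v x t = x (t + a)" "\<forall>t. h *v x t = x (t + b)" for a b t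
    using that[rule_format, of "t - a"] by (simp add: algebra_simps)
  show "\<sigma> = \<tau>"
  proof (rule ccontr)
    assume "\<sigma> \<noteq> \<tau>"
    then show False
      using minper[of "\<sigma> - \<tau>"] minper[of "\<tau> - \<sigma>"] shift_diff \<sigma> assms(2-4)
      by (cases "\<sigma> < \<tau>") auto
  qed
qed (use assms in auto)

lemma spatiotemporal_shift:
  fixes x :: "real \<Rightarrow> real^'n" and h :: "real^'n^'n"
  assumes sol: "\<And>t. (x has_vector_derivative f (x t)) (at t)"
    and per: "\<And>t. x (t + p) = x t" "0 < p"
    and lipschitz: "C-lipschitz_on S f" "range x \<subseteq> S"
    and equiv: "\<And>z. f (h *v z) = h *v f z"
    and orbit: "(\<lambda>v. h *v v) ` range x = range x"
  shows "\<exists>\<tau>. 0 \<le> \<tau> \<and> \<tau> < p \<and> (\<forall>t. h *v x t = x (t + \<tau>))"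
proof -
  obtain t0 where "h *v x 0 = x t0"
    using orbit by blast
  then obtain \<tau> where \<tau>: "0 \<le> \<tau>" "\<tau> < p" "h *v x 0 = x \<tau>"
    using periodic_value_in_period[of x p, OF per] by metis
  have "(\<lambda>t. h *v x t) = (\<lambda>t. x (t + \<tau>))"
  proof (rule ode_solutions_eq[OF _ _ lipschitz(1)])
    show "((\<lambda>t. h *v x t) has_vector_derivative f (h *v x t)) (at t)" for t
      unfolding equiv by (rule bounded_linear.has_vector_derivative[OF matrix_vector_mul_bounded_linear sol])
    show "((\<lambda>t. x (t + \<tau>)) has_vector_derivative f (x (t + \<tau>))) (at t)" for t
      using vector_diff_chain_at[OF has_vector_derivative_add_const[THEN iffD2, OF has_vector_derivative_id] sol]
      by (simp add: o_def)
  qed (use orbit lipschitz(2) \<tau> in auto)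
  then show ?thesis
    using \<tau> by metis
qed

lemma spatiotemporal_symmetry_theta:
  fixes f :: "real^'n \<Rightarrow> real^'n" and x :: "real \<Rightarrow> real^'n" and h :: "real^'n^'n"
  assumes deriv: "\<And>z. (f has_derivative blinfun_apply (Df z)) (at z)" and "continuous_on UNIV Df"
    and equiv: "\<And>z. f (h *v z) = h *v f z"
    and sol: "\<And>t. (x has_vector_derivative f (x t)) (at t)"
    and per: "\<And>t. x (t + p) = x t" "0 < p"
    and minper: "\<And>q. 0 < q \<Longrightarrow> q < p \<Longrightarrow> \<not> (\<forall>t. x (t + q) = x t)"
    and orbit: "(\<lambda>v. h *v v) ` range x = range x"
  shows "h *v x t = x (t + theta p x h)"
proof -
  have "continuous_on UNIV x"
    using sol by (meson continuous_at_imp_continuous_on has_vector_derivative_continuous)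
  then obtain R where "\<And>t. norm (x t) \<le> R"
    using periodic_bounded[of x p, OF per] by blast
  then have orbit_in_ball: "range x \<subseteq> cball 0 R"
    by auto
  obtain C where lipschitz: "C-lipschitz_on (cball 0 R) f"
    using continuous_derivative_imp_lipschitz_on[OF deriv \<open>continuous_on UNIV Df\<close> compact_cball convex_cball] by blast
  obtain \<tau> where "0 \<le> \<tau>" "\<tau> < p" "\<And>t. h *v x t = x (t + \<tau>)"
    using spatiotemporal_shift[OF sol per lipschitz orbit_in_ball equiv orbit] by blast
  with theta_eqI[OF minper] show ?thesis
    by simp
qed

section \<open>The twisted monodromy identity\<close>

theorem lemma3p2:
  fixes f :: "real^'n \<Rightarrow> real^'n"
    and Df :: "real^'n \<Rightarrow> (real^'n) \<Rightarrow>\<^sub>L (real^'n)"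
    and G :: "(real^'n^'n) set"
    and x :: "real \<Rightarrow> real^'n"
    and p b :: real and n m :: nat and h :: "real^'n^'n"
  assumes deriv: "\<And>z. (f has_derivative blinfun_apply (Df z)) (at z)"
    and C2: "\<exists>D2. (\<forall>z. (Df has_derivative blinfun_apply (D2 z)) (at z)) \<and> continuous_on UNIV D2"
    and grp: "compact_orth_group G"
    and equiv: "equivariant G f"
    and sol: "\<And>t. (x has_vector_derivative f (x t)) (at t)"
    and p_pos: "p > 0"
    and per: "\<And>t. x (t + p) = x t"
    and minper: "\<And>q. 0 < q \<Longrightarrow> q < p \<Longrightarrow> \<not> (\<forall>t. x (t + q) = x t)"
    and wave: "mat_group (Hgrp G x) Mod Kgrp G x \<cong> integer_mod_group n"
    and hH: "h \<in> Hgrp G x"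
    and m: "m \<in> {1..n}"
    and th: "theta p x h = real m / real n * p"
  shows "\<forall>phi \<in> Cspace (theta p x h).
           (solop Df x b h (theta p x h) p 0 ^^ m) phi =
           (mat_act h ^^ n)
             (((mat_act (matrix_inv h) \<circ> solop Df x b h (theta p x h) (real m / real n * p) 0) ^^ n) phi)"
proof -
  have "h \<in> G" and orbit: "(\<lambda>v. h *v v) ` range x = range x"
    using hH by (simp_all add: Hgrp_def)
  then have orthogonal: "orthogonal_matrix h" and equiv_h: "\<And>z. f (h *v z) = h *v f z"
    using grp equiv by (auto simp: compact_orth_group_def equivariant_def)
  have Df_cont: "continuous_on UNIV Df"
    using C2 by (meson continuous_at_imp_continuous_on has_derivative_continuous)
  have x_cont: "continuous_on UNIV x"
    using sol by (meson continuous_at_imp_continuous_on has_vector_derivative_continuous)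
  then obtain L where "\<And>t. norm (Df (x t)) \<le> L"
    using periodic_bounded[of "\<lambda>t. Df (x t)" p] per p_pos continuous_on_compose2[OF Df_cont x_cont]
    by auto
  moreover have "0 \<le> theta p x h"
    using th p_pos by simp
  ultimately interpret linear_delay_equation Df x b h "theta p x h" L
    using continuous_on_compose2[OF Df_cont x_cont] by unfold_locales auto
  have shift: "h *v x t = x (t + theta p x h)" for t
    by (rule spatiotemporal_symmetry_theta[OF deriv Df_cont equiv_h sol per p_pos minper orbit])
  have "Df (x (r + theta p x h)) (h *v w) = h *v Df (x r) w" for r w
    using derivative_equivariant[OF deriv equiv_h] by (simp flip: shift)
  moreover have "real n * theta p x h = real m * p"
    using th m by simp
  ultimately show ?thesis
    using monodromy_power_eq_twisted[OF _ per _ _ orthogonal_matrix_inv[OF orthogonal]] p_pos th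
    by simp
qed

end
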